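(* Let $X$ be a nonempty set, let $\Theta\subseteq\mathbb{R}$ be a nondegenerate open interval, and let $\varrho:X\times\Theta\to\mathbb{R}$ be a function. Assume that, for all $z\in X$, the map $\Theta\ni t\mapsto\varrho(z,t)$ is continuously differentiable and that the function $\psi:X\times\Theta\to\mathbb{R}$ defined by $$\psi(z,t):=-\partial_2\varrho(z,t),\qquad z\in X,\ t\in\Theta,$$ belongs to $\Psi[T,Z_1](X,\Theta)$. Write $\vartheta_n:=\vartheta_{n,\psi}:X^n\to\Theta$ for $n\in\mathbb{N}$. In addition, suppose that (a) for all $t\in\Theta$, there exist $x,y\in X$ such that $\vartheta_1(x)<t<\vartheta_1(y)$, (b) for all $z\in X$, the map $\Theta\setminus\{\vartheta_1(z)\}\ni t\mapsto\varrho(z,t)$ is twice continuously differentiable. Then there exists a function $\varrho^*:X\times\Theta\to\mathbb{R}$ such that (i) for all $z\in X$, the map $\Theta\ni t\mapsto\varrho^*(z,t)$ is convex and continuously differentiable, (ii) for all $n\in\mathbb{N}$ and $x_1,\dots,x_n\in X$, $$\{\vartheta_n(x_1,\dots,x_n)\}=\operatorname{arg\,min}_{t\in\Theta}\sum_{i=1}^n\varrho(x_i,t)=\operatorname{arg\,min}_{t\in\Theta}\sum_{i=1}^n\varrho^*(x_i,t),$$ that is, $\vartheta_n(x_1,\dots,x_n)$ is the common unique (global) minimum point in $\Theta$ of the two maps $\Theta\ni t\mapsto\sum_{i=1}^n\varrho(x_i,t)$ and $\Theta\ni t\mapsto\sum_{i=1}^n\varrho^*(x_i,t)$.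
   Context: $\mathbb{N}$ is the set of positive integers. An interval is nondegenerate if it contains at least two distinct points. $\partial_2\varrho$ denotes the partial derivative of $\varrho$ with respect to its second variable. For $f:\Theta\to\mathbb{R}$, $\operatorname{arg\,min}_{t\in\Theta}f(t):=\{t\in\Theta: f(s)\geq f(t)\text{ for all }s\in\Theta\}$. $\Psi(X,\Theta)$ denotes the class of functions $\psi:X\times\Theta\to\mathbb{R}$ such that, for all $x\in X$, there exist $t_+,t_-\in\Theta$ with $t_+<t_-$ and $\psi(x,t_+)>0>\psi(x,t_-)$. For $n\in\mathbb{N}$, $\psi\in\Psi(X,\Theta)$ has property $[T_n]$ if there exists a (necessarily unique) map $\vartheta_{n,\psi}:X^n\to\Theta$ such that, for all $(x_1,\dots,x_n)\in X^n$ and $t\in\Theta$, $\sum_{i=1}^n\psi(x_i,t)>0$ if $t<\vartheta_{n,\psi}(x_1,\dots,x_n)$ and $\sum_{i=1}^n\psi(x_i,t)<0$ if $t>\vartheta_{n,\psi}(x_1,\dots,x_n)$. It has property $[T]$ if it has property $[T_n]$ for every $n\in\mathbb{N}$. It has property $[Z_1]$ if it has property $[T_1]$ and $\psi(x,\vartheta_{1,\psi}(x))=0$ for all $x\in X$. $\Psi[T,Z_1](X,\Theta)$ denotes the class of those $\psi\in\Psi(X,\Theta)$ having both properties $[T]$ and $[Z_1]$. *)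

theory Defs
  imports "HOL-Analysis.Analysis" "HOL-Library.NList"
begin

text \<open>Functions on \<open>X \<times> \<Theta>\<close> are curried total functions of which only the values
  on \<open>X\<close> and \<open>\<Theta>\<close> are used.  The power \<open>X\<close> to the \<open>n\<close> is \<^term>\<open>nlists n X\<close>, so that
  \<open>[x]\<close> is the one-tuple formed by \<open>x\<close>.\<close>

definition Psi :: "'a set \<Rightarrow> real set \<Rightarrow> ('a \<Rightarrow> real \<Rightarrow> real) set" where
  "Psi X \<Theta> = {\<psi>. \<forall>x\<in>X. \<exists>tp\<in>\<Theta>. \<exists>tm\<in>\<Theta>. tp < tm \<and> \<psi> x tp > 0 \<and> 0 > \<psi> x tm}"

text \<open>Extensionality (\<open>\<rightarrow>\<^sub>E\<close>) makes the map unique as a HOL function, as shown below;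
  this is what justifies the definite description in \<open>vartheta\<close>.\<close>

definition is_sign_change_map ::
  "'a set \<Rightarrow> real set \<Rightarrow> ('a \<Rightarrow> real \<Rightarrow> real) \<Rightarrow> nat \<Rightarrow> ('a list \<Rightarrow> real) \<Rightarrow> bool" where
  "is_sign_change_map X \<Theta> \<psi> n \<theta> \<longleftrightarrow>
     \<theta> \<in> nlists n X \<rightarrow>\<^sub>E \<Theta> \<and>
     (\<forall>xs\<in>nlists n X. \<forall>t\<in>\<Theta>.
        (t < \<theta> xs \<longrightarrow> (\<Sum>x\<leftarrow>xs. \<psi> x t) > 0) \<and>
        (t > \<theta> xs \<longrightarrow> (\<Sum>x\<leftarrow>xs. \<psi> x t) < 0))"

lemma is_sign_change_map_unique:
  assumes int: "is_interval \<Theta>"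
    and \<theta>: "is_sign_change_map X \<Theta> \<psi> n \<theta>" and \<eta>: "is_sign_change_map X \<Theta> \<psi> n \<eta>"
  shows "\<theta> = \<eta>"
proof -
  have le: "f xs \<le> g xs" if f: "is_sign_change_map X \<Theta> \<psi> n f"
    and g: "is_sign_change_map X \<Theta> \<psi> n g" and xs: "xs \<in> nlists n X" for f g xs
  proof (rule ccontr)
    assume "\<not> f xs \<le> g xs"
    then obtain t where t: "g xs < t" "t < f xs" using dense not_le by blast
    have "f xs \<in> \<Theta>" "g xs \<in> \<Theta>"
      using f g xs by (auto simp: is_sign_change_map_def dest: PiE_mem)
    then have "t \<in> \<Theta>" using int t unfolding is_interval_1 by (meson less_imp_le)
    then show False using f g xs t unfolding is_sign_change_map_def by (meson less_asym)
  qed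
  show ?thesis
  proof (rule PiE_ext)
    show "\<theta> \<in> nlists n X \<rightarrow>\<^sub>E \<Theta>" "\<eta> \<in> nlists n X \<rightarrow>\<^sub>E \<Theta>"
      using \<theta> \<eta> by (auto simp: is_sign_change_map_def)
    show "\<theta> xs = \<eta> xs" if "xs \<in> nlists n X" for xs
      using le[OF \<theta> \<eta> that] le[OF \<eta> \<theta> that] by simp
  qed
qed

definition property_T_n :: "'a set \<Rightarrow> real set \<Rightarrow> ('a \<Rightarrow> real \<Rightarrow> real) \<Rightarrow> nat \<Rightarrow> bool" where
  "property_T_n X \<Theta> \<psi> n \<longleftrightarrow> (\<exists>\<theta>. is_sign_change_map X \<Theta> \<psi> n \<theta>)"

definition vartheta :: "'a set \<Rightarrow> real set \<Rightarrow> ('a \<Rightarrow> real \<Rightarrow> real) \<Rightarrow> nat \<Rightarrow> 'a list \<Rightarrow> real" where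
  "vartheta X \<Theta> \<psi> n = (THE \<theta>. is_sign_change_map X \<Theta> \<psi> n \<theta>)"

lemma is_sign_change_map_vartheta:
  assumes "is_interval \<Theta>" "property_T_n X \<Theta> \<psi> n"
  shows "is_sign_change_map X \<Theta> \<psi> n (vartheta X \<Theta> \<psi> n)"
  unfolding vartheta_def
  using assms(2) is_sign_change_map_unique[OF assms(1)]
  by (metis property_T_n_def theI)

definition property_T :: "'a set \<Rightarrow> real set \<Rightarrow> ('a \<Rightarrow> real \<Rightarrow> real) \<Rightarrow> bool" where
  "property_T X \<Theta> \<psi> \<longleftrightarrow> (\<forall>n\<ge>1. property_T_n X \<Theta> \<psi> n)"

definition property_Z_1 :: "'a set \<Rightarrow> real set \<Rightarrow> ('a \<Rightarrow> real \<Rightarrow> real) \<Rightarrow> bool" where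
  "property_Z_1 X \<Theta> \<psi> \<longleftrightarrow>
     property_T_n X \<Theta> \<psi> 1 \<and> (\<forall>x\<in>X. \<psi> x (vartheta X \<Theta> \<psi> 1 [x]) = 0)"

definition Psi_T_Z1 :: "'a set \<Rightarrow> real set \<Rightarrow> ('a \<Rightarrow> real \<Rightarrow> real) set" where
  "Psi_T_Z1 X \<Theta> = {\<psi> \<in> Psi X \<Theta>. property_T X \<Theta> \<psi> \<and> property_Z_1 X \<Theta> \<psi>}"

definition argmin_set :: "real set \<Rightarrow> (real \<Rightarrow> real) \<Rightarrow> real set" where
  "argmin_set \<Theta> f = {t \<in> \<Theta>. \<forall>s\<in>\<Theta>. f s \<ge> f t}"

text \<open>Intended for open sets: both \<^const>\<open>deriv\<close> and \<open>C1_differentiable_on\<close> refer to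
  two-sided derivatives in the ambient real line.\<close>

definition C2_differentiable_on_open :: "(real \<Rightarrow> real) \<Rightarrow> real set \<Rightarrow> bool" where
  "C2_differentiable_on_open f S \<longleftrightarrow>
     f C1_differentiable_on S \<and> deriv f C1_differentiable_on S"

end

theory Submission
  imports Defs
begin

text \<open>Write \<open>\<theta> z\<close> for the sign change \<open>\<vartheta>\<^sub>1(z)\<close> of \<open>\<psi>(z, \<cdot>)\<close>.  A positive continuous
  factor \<open>p\<close> on \<open>\<Theta>\<close> changes no sign of any sum \<open>\<Sum>\<psi>(x\<^sub>i, \<cdot>)\<close>, so that a primitive of
  \<open>- p \<psi>(z, \<cdot>)\<close> may serve as \<open>\<rho>\<^sup>*(z, \<cdot>)\<close> as soon as \<open>p\<close> makes every \<open>p \<psi>(z, \<cdot>)\<close>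
  nonincreasing: it is then convex and continuously differentiable, and the sums of \<open>\<rho>\<close> and those
  of \<open>\<rho>\<^sup>*\<close> decrease strictly before \<open>\<vartheta>\<^sub>n\<close> and increase strictly after it.

  With \<open>p = exp(- H)\<close> and \<open>F z = ln \<bar>\<psi>(z, \<cdot>)\<bar>\<close>, monotonicity of \<open>p \<psi>(z, \<cdot>)\<close> says that
  the increments of \<open>H\<close> dominate those of \<open>F z\<close> to the left of \<open>\<theta> z\<close>, where \<open>\<psi>(z, \<cdot>) > 0\<close>,
  and are dominated by them to the right of \<open>\<theta> z\<close>, where \<open>\<psi>(z, \<cdot>) < 0\<close>.  The two demands are
  compatible: if \<open>\<theta> x < s < t < \<theta> y\<close>, then the quotient \<open>- \<psi>(x, \<cdot>) / \<psi>(y, \<cdot>)\<close> does not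
  decrease from \<open>s\<close> to \<open>t\<close>, since otherwise a rational number between its two values would
  give a sample of copies of \<open>x\<close> and \<open>y\<close> for which the sum changes its sign from minus to plus
  (\<open>log_increment_le\<close>).

  Given this, let the increment of \<open>H\<close> over \<open>[s, t]\<close> be the supremum of the sums of increments,
  over the pieces of a subdivision of \<open>[s, t]\<close>, of functions \<open>F y\<close> with \<open>y\<close> depending on
  the piece and \<open>\<theta> y\<close> to the right of it.  This supremum is additive in the interval because
  subdivisions can be refined, it dominates the increments of each such \<open>F y\<close>, and it is dominated
  by those of every \<open>F x\<close> with \<open>\<theta> x < s\<close> (\<open>exists_function_separating_increments\<close>).
  Squeezed between increments of continuous functions, \<open>H\<close> is continuous.\<close>

section \<open>A function with prescribed bounds on its increments\<close>

text \<open>The number \<open>v\<close> is the sum, over a subdivision of \<open>[s, t]\<close>, of increments of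
  functions \<open>F y\<close>, with \<open>y\<close> chosen anew on each piece among those whose threshold \<open>\<theta> y\<close> lies
  to the right of the piece.  Any function whose increments dominate those of each \<open>F y\<close> to the
  left of \<open>\<theta> y\<close> must grow by at least \<open>v\<close> from \<open>s\<close> to \<open>t\<close>.\<close>

inductive increment_chain :: "'a set \<Rightarrow> ('a \<Rightarrow> real) \<Rightarrow> ('a \<Rightarrow> real \<Rightarrow> real) \<Rightarrow> real \<Rightarrow> real \<Rightarrow> real \<Rightarrow> bool"
  for X \<theta> F where
  base: "y \<in> X \<Longrightarrow> s \<le> t \<Longrightarrow> t < \<theta> y \<Longrightarrow> increment_chain X \<theta> F s t (F y t - F y s)"
| join: "increment_chain X \<theta> F s t v \<Longrightarrow> increment_chain X \<theta> F t u w \<Longrightarrow>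
    increment_chain X \<theta> F s u (v + w)"

lemma increment_chain_le: "increment_chain X \<theta> F s t v \<Longrightarrow> s \<le> t"
  by (induction rule: increment_chain.induct) auto

text \<open>Inserting a further point into the subdivision keeps the sum, because the same \<open>F y\<close> is
  admissible on both halves of a piece.  This makes the supremum below additive rather than merely
  superadditive.\<close>

lemma increment_chain_split:
  assumes "increment_chain X \<theta> F s u v" "s \<le> t" "t \<le> u"
  shows "\<exists>v1 v2. increment_chain X \<theta> F s t v1 \<and> increment_chain X \<theta> F t u v2 \<and> v = v1 + v2"
  using assms
proof (induction arbitrary: t rule: increment_chain.induct)
  case (base y s u)
  have "increment_chain X \<theta> F s t (F y t - F y s)" "increment_chain X \<theta> F t u (F y u - F y t)"
    using base by (auto intro!: increment_chain.base)
  moreover have "F y u - F y s = (F y t - F y s) + (F y u - F y t)" by simp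
  ultimately show ?case by blast
next
  case (join s r v u w)
  show ?case
  proof (cases "t \<le> r")
    case True
    then obtain v1 v2 where v: "increment_chain X \<theta> F s t v1" "increment_chain X \<theta> F t r v2"
      "v = v1 + v2" using join by blast
    have "increment_chain X \<theta> F t u (v2 + w)" using increment_chain.join[OF v(2) join.hyps(2)] .
    then show ?thesis using v by (metis add.assoc)
  next
    case False
    then obtain w1 w2 where w: "increment_chain X \<theta> F r t w1" "increment_chain X \<theta> F t u w2"
      "w = w1 + w2" using join by (meson linear)
    have "increment_chain X \<theta> F s t (v + w1)" using increment_chain.join[OF join.hyps(1) w(1)] .
    then show ?thesis using w by (metis add.assoc)
  qed
qed

text \<open>All pieces lie to the right of \<open>\<theta> x\<close>, so that the hypothesis bounds each summand by the
  increment of the same function \<open>F x\<close> over its piece, and these telescope.\<close>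

lemma increment_chain_upper_bound:
  assumes int: "is_interval I"
    and cross: "\<And>x y s t. x \<in> X \<Longrightarrow> y \<in> X \<Longrightarrow> s \<in> I \<Longrightarrow> t \<in> I \<Longrightarrow>
      \<theta> x < s \<Longrightarrow> s \<le> t \<Longrightarrow> t < \<theta> y \<Longrightarrow> F y t - F y s \<le> F x t - F x s"
    and x: "x \<in> X"
    and "increment_chain X \<theta> F s t v" "s \<in> I" "t \<in> I" "\<theta> x < s"
  shows "v \<le> F x t - F x s"
  using assms(4-)
proof (induction rule: increment_chain.induct)
  case (base y s t)
  then show ?case using cross x by blast
next
  case (join s t v u w)
  have st: "s \<le> t" "t \<le> u" using join.hyps increment_chain_le by blast+
  then have "t \<in> I" using join.prems int unfolding is_interval_1 by blast
  then show ?case using join.IH join.prems st by fastforce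
qed

text \<open>The increment of \<open>H\<close> over an interval is the supremum of the values of the chains
  that lead from one end to the other.  A single \<open>F x\<close> with \<open>\<theta> x\<close> to the left of the interval
  makes it finite, and a single \<open>F y\<close> with \<open>\<theta> y\<close> to the right provides a chain.\<close>

lemma exists_function_separating_increments:
  fixes F :: "'a \<Rightarrow> real \<Rightarrow> real" and \<theta> :: "'a \<Rightarrow> real"
  assumes int: "is_interval I"
    and cross: "\<And>x y s t. x \<in> X \<Longrightarrow> y \<in> X \<Longrightarrow> s \<in> I \<Longrightarrow> t \<in> I \<Longrightarrow>
      \<theta> x < s \<Longrightarrow> s \<le> t \<Longrightarrow> t < \<theta> y \<Longrightarrow> F y t - F y s \<le> F x t - F x s"
    and below: "\<And>t. t \<in> I \<Longrightarrow> \<exists>x\<in>X. \<theta> x < t"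
    and above: "\<And>t. t \<in> I \<Longrightarrow> \<exists>y\<in>X. t < \<theta> y"
  obtains H where
    "\<And>y s t. y \<in> X \<Longrightarrow> s \<in> I \<Longrightarrow> t \<in> I \<Longrightarrow> s \<le> t \<Longrightarrow> t < \<theta> y \<Longrightarrow> F y t - F y s \<le> H t - H s"
    "\<And>x s t. x \<in> X \<Longrightarrow> s \<in> I \<Longrightarrow> t \<in> I \<Longrightarrow> s \<le> t \<Longrightarrow> \<theta> x < s \<Longrightarrow> H t - H s \<le> F x t - F x s"
proof (cases "I = {}")
  case True
  then show ?thesis using that by blast
next
  case False
  then obtain c where c: "c \<in> I" by blast
  let ?C = "increment_chain X \<theta> F"
  define V where "V s t = Sup {v. ?C s t v}" for s t
  have ub: "v \<le> F x t - F x s"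
    if "x \<in> X" "?C s t v" "s \<in> I" "t \<in> I" "\<theta> x < s" for x s t v
    using increment_chain_upper_bound[of I X \<theta> F, OF int cross] that by simp
  have bdd: "bdd_above {v. ?C s t v}" if st: "s \<in> I" "t \<in> I" for s t
  proof -
    obtain x where x: "x \<in> X" "\<theta> x < s" using below[OF st(1)] by blast
    show ?thesis using ub[OF x(1) _ st x(2)] by (intro bdd_aboveI[of _ "F x t - F x s"]) simp
  qed
  have ex: "\<exists>v. ?C s t v" if st: "s \<in> I" "t \<in> I" "s \<le> t" for s t
  proof -
    obtain y where "y \<in> X" "t < \<theta> y" using above[OF st(2)] by blast
    then show ?thesis using increment_chain.base st(3) by fast
  qed
  have VI: "v \<le> V s t" if "?C s t v" "s \<in> I" "t \<in> I" for s t v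
    unfolding V_def using that bdd by (intro cSup_upper) auto
  have VL: "V s t \<le> b" if "s \<in> I" "t \<in> I" "s \<le> t" "\<And>v. ?C s t v \<Longrightarrow> v \<le> b" for s t b
    unfolding V_def using that ex by (intro cSup_least) auto
  have add: "V s u = V s t + V t u" if I: "s \<in> I" "t \<in> I" "u \<in> I" and le: "s \<le> t" "t \<le> u" for s t u
  proof (rule antisym)
    show "V s u \<le> V s t + V t u"
    proof (rule VL)
      fix v assume "?C s u v"
      then obtain v1 v2 where "?C s t v1" "?C t u v2" "v = v1 + v2"
        using increment_chain_split le by blast
      then show "v \<le> V s t + V t u" using VI I by (simp add: add_mono)
    qed (use I le in auto)
    have "V s t \<le> V s u - w" if w: "?C t u w" for w
    proof (rule VL)
      fix v assume "?C s t v"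
      then have "v + w \<le> V s u" using VI increment_chain.join w I by metis
      then show "v \<le> V s u - w" by simp
    qed (use I le in auto)
    then have "V t u \<le> V s u - V s t"
      using I le by (intro VL) (auto simp: algebra_simps)
    then show "V s t + V t u \<le> V s u" by simp
  qed
  \<comment> \<open>At \<open>t = c\<close> additivity gives \<open>V c c = 0\<close>, so that the two branches fit together.\<close>
  define H where "H t = (if c \<le> t then V c t else - V t c)" for t
  have inc: "H t - H s = V s t" if "s \<in> I" "t \<in> I" "s \<le> t" for s t
  proof -
    consider "c \<le> s" | "s < c" "c \<le> t" | "t < c" by linarith
    then show ?thesis
    proof cases
      case 1 then show ?thesis using add[of c s t] that c by (simp add: H_def)
    next
      case 2 then show ?thesis using add[of s c t] that c by (simp add: H_def)
    next
      case 3 then show ?thesis using add[of s t c] that c by (simp add: H_def)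
    qed
  qed
  show ?thesis
  proof (rule that)
    show "F y t - F y s \<le> H t - H s"
      if "y \<in> X" "s \<in> I" "t \<in> I" "s \<le> t" "t < \<theta> y" for y s t
      using VI increment_chain.base[of y X s t \<theta> F] inc that by metis
    show "H t - H s \<le> F x t - F x s"
      if "x \<in> X" "s \<in> I" "t \<in> I" "s \<le> t" "\<theta> x < s" for x s t
      unfolding inc[OF that(2,3,4)] using ub that by (intro VL) auto
  qed
qed

section \<open>The monotonizing factor\<close>

text \<open>The sample consisting of \<open>n\<close> copies of \<open>x\<close> and \<open>m\<close> copies of \<open>y\<close> compares the
  quotient \<open>- \<psi>(x, \<cdot>) / \<psi>(y, \<cdot>)\<close> with the rational number \<open>m / n\<close>, and property \<open>[T]\<close>
  forbids the quotient to pass from above \<open>m / n\<close> to below it.\<close>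

lemma log_increment_le:
  fixes \<psi> :: "'a \<Rightarrow> real \<Rightarrow> real"
  assumes change: "\<And>xs. xs \<noteq> [] \<Longrightarrow> set xs \<subseteq> {x, y} \<Longrightarrow>
      (\<Sum>z\<leftarrow>xs. \<psi> z s) < 0 \<Longrightarrow> (\<Sum>z\<leftarrow>xs. \<psi> z t) \<le> 0"
    and neg: "\<psi> x s < 0" "\<psi> x t < 0" and pos: "\<psi> y s > 0" "\<psi> y t > 0"
  shows "ln \<bar>\<psi> y t\<bar> - ln \<bar>\<psi> y s\<bar> \<le> ln \<bar>\<psi> x t\<bar> - ln \<bar>\<psi> x s\<bar>"
proof -
  have "- \<psi> x s / \<psi> y s \<le> - \<psi> x t / \<psi> y t"
  proof (rule ccontr)
    assume "\<not> ?thesis"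
    then obtain q where q: "q \<in> \<rat>" "- \<psi> x t / \<psi> y t < q" "q < - \<psi> x s / \<psi> y s"
      using Rats_dense_in_real[of "- \<psi> x t / \<psi> y t" "- \<psi> x s / \<psi> y s"] by auto
    have "q > 0" using q(2) neg(2) pos(2) by (smt (verit) divide_pos_pos)
    then obtain m n :: nat where mn: "n \<noteq> 0" "q = real m / real n"
      using Rats_abs_nat_div_natE[OF q(1)] by (metis abs_of_pos)
    \<comment> \<open>At \<open>s\<close> and at \<open>t\<close>, the sum over this sample has the sign of \<open>q\<close> minus the quotient.\<close>
    let ?xs = "replicate n x @ replicate m y"
    have sum: "(\<Sum>z\<leftarrow>?xs. \<psi> z r) = real n * \<psi> x r + real m * \<psi> y r" for r
      by (simp add: sum_list_replicate)
    have "(\<Sum>z\<leftarrow>?xs. \<psi> z s) < 0"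
      using q(3) mn pos(1) unfolding sum by (simp add: field_simps)
    moreover have "(\<Sum>z\<leftarrow>?xs. \<psi> z t) > 0"
      using q(2) mn pos(2) unfolding sum by (simp add: field_simps)
    ultimately show False using change[of ?xs] mn(1) by force
  qed
  then have "ln (- \<psi> x s / \<psi> y s) \<le> ln (- \<psi> x t / \<psi> y t)"
    using neg pos by (subst ln_le_cancel_iff) (auto intro!: divide_pos_pos divide_neg_pos)
  moreover have "ln (- u / w) = ln (- u) - ln w" if "u < 0" "w > 0" for u w :: real
    using ln_div[of "- u" w] that by simp
  ultimately show ?thesis using neg pos by simp
qed

lemma continuous_of_squeezed_increments:
  fixes H :: "real \<Rightarrow> real"
  assumes "isCont f t0" "isCont g t0"
    and le: "eventually (\<lambda>t. \<bar>H t - H t0\<bar> \<le> \<bar>f t - f t0\<bar> + \<bar>g t - g t0\<bar>) (nhds t0)"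
  shows "isCont H t0"
proof -
  have lim: "((\<lambda>t. \<bar>f t - f t0\<bar> + \<bar>g t - g t0\<bar>) \<longlongrightarrow> \<bar>f t0 - f t0\<bar> + \<bar>g t0 - g t0\<bar>) (at t0)"
    using assms(1,2) unfolding isCont_def by (intro tendsto_intros)
  have "((\<lambda>t. H t - H t0) \<longlongrightarrow> 0) (at t0)"
  proof (rule Lim_null_comparison)
    show "eventually (\<lambda>t. norm (H t - H t0) \<le> \<bar>f t - f t0\<bar> + \<bar>g t - g t0\<bar>) (at t0)"
      using le unfolding eventually_at_filter by (auto elim: eventually_mono)
  qed (use lim in simp)
  then show ?thesis unfolding isCont_def by (simp add: LIM_zero_iff)
qed

text \<open>The factor is \<open>exp (- H)\<close>, where \<open>H\<close> separates the increments of the functions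
  \<open>ln \<bar>\<psi>(z, \<cdot>)\<bar>\<close>.  It is continuous at \<open>t0\<close> because, for indices with
  \<open>\<theta> x < t0 < \<theta> y\<close>, the increments of \<open>H\<close> near \<open>t0\<close> are enclosed by those of the functions
  belonging to \<open>x\<close> and \<open>y\<close>, which have no singularity there.\<close>

lemma exists_monotonizing_factor:
  fixes \<psi> :: "'a \<Rightarrow> real \<Rightarrow> real" and \<theta> :: "'a \<Rightarrow> real"
  assumes int: "is_interval \<Theta>" and op: "open \<Theta>"
    and cont: "\<And>z. z \<in> X \<Longrightarrow> continuous_on \<Theta> (\<psi> z)"
    and pos: "\<And>z t. z \<in> X \<Longrightarrow> t \<in> \<Theta> \<Longrightarrow> t < \<theta> z \<Longrightarrow> \<psi> z t > 0"
    and neg: "\<And>z t. z \<in> X \<Longrightarrow> t \<in> \<Theta> \<Longrightarrow> \<theta> z < t \<Longrightarrow> \<psi> z t < 0"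
    and zero: "\<And>z. z \<in> X \<Longrightarrow> \<psi> z (\<theta> z) = 0"
    and dense: "\<And>t. t \<in> \<Theta> \<Longrightarrow> \<exists>x\<in>X. \<exists>y\<in>X. \<theta> x < t \<and> t < \<theta> y"
    and change: "\<And>xs s t. xs \<noteq> [] \<Longrightarrow> set xs \<subseteq> X \<Longrightarrow> s \<in> \<Theta> \<Longrightarrow> t \<in> \<Theta> \<Longrightarrow> s \<le> t \<Longrightarrow>
      (\<Sum>z\<leftarrow>xs. \<psi> z s) < 0 \<Longrightarrow> (\<Sum>z\<leftarrow>xs. \<psi> z t) \<le> 0"
  obtains p where "continuous_on \<Theta> p" "\<And>t. p t > 0"
    "\<And>z. z \<in> X \<Longrightarrow> antimono_on \<Theta> (\<lambda>t. p t * \<psi> z t)"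
proof -
  define F where "F z t = ln \<bar>\<psi> z t\<bar>" for z t
  have nonzero: "\<psi> z t \<noteq> 0" if "z \<in> X" "t \<in> \<Theta>" "t \<noteq> \<theta> z" for z t
    using pos[of z t] neg[of z t] that by fastforce
  have cross: "F y t - F y s \<le> F x t - F x s"
    if "x \<in> X" "y \<in> X" "s \<in> \<Theta>" "t \<in> \<Theta>" "\<theta> x < s" "s \<le> t" "t < \<theta> y" for x y s t
    unfolding F_def
  proof (rule log_increment_le)
    show "(\<Sum>z\<leftarrow>xs. \<psi> z t) \<le> 0"
      if "xs \<noteq> []" "set xs \<subseteq> {x, y}" "(\<Sum>z\<leftarrow>xs. \<psi> z s) < 0" for xs
      using change[of xs s t] \<open>x \<in> X\<close> \<open>y \<in> X\<close> \<open>s \<in> \<Theta>\<close> \<open>t \<in> \<Theta>\<close> \<open>s \<le> t\<close> that by blast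
  qed (use that pos neg in auto)
  obtain H where lower: "\<And>y s t. y \<in> X \<Longrightarrow> s \<in> \<Theta> \<Longrightarrow> t \<in> \<Theta> \<Longrightarrow> s \<le> t \<Longrightarrow> t < \<theta> y \<Longrightarrow>
      F y t - F y s \<le> H t - H s"
    and upper: "\<And>x s t. x \<in> X \<Longrightarrow> s \<in> \<Theta> \<Longrightarrow> t \<in> \<Theta> \<Longrightarrow> s \<le> t \<Longrightarrow> \<theta> x < s \<Longrightarrow>
      H t - H s \<le> F x t - F x s"
  proof (rule exists_function_separating_increments[of \<Theta> X \<theta> F, OF int cross])
    show "\<exists>x\<in>X. \<theta> x < t" "\<exists>y\<in>X. t < \<theta> y" if "t \<in> \<Theta>" for t
      using dense[OF that] by blast+
  qed (assumption | rule that)+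
  have "isCont H t0" if t0: "t0 \<in> \<Theta>" for t0
  proof -
    obtain x y where xy: "x \<in> X" "y \<in> X" "\<theta> x < t0" "t0 < \<theta> y" using dense t0 by blast
    have isF: "isCont (F z) t0" if "z \<in> X" "t0 \<noteq> \<theta> z" for z
      unfolding F_def
      using cont[OF that(1)] op t0 nonzero[OF that(1) t0 that(2)]
      by (intro continuous_intros) (auto simp: continuous_on_eq_continuous_at)
    have "open (\<Theta> \<inter> {\<theta> x<..<\<theta> y})" using op by auto
    then have "eventually (\<lambda>t. t \<in> \<Theta> \<inter> {\<theta> x<..<\<theta> y}) (nhds t0)"
      using t0 xy by (intro eventually_nhds_in_open) auto
    then have "eventually (\<lambda>t. \<bar>H t - H t0\<bar> \<le> \<bar>F x t - F x t0\<bar> + \<bar>F y t - F y t0\<bar>) (nhds t0)"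
    proof eventually_elim
      case (elim t)
      show ?case
      proof (cases "t0 \<le> t")
        case True
        then show ?thesis using lower[of y t0 t] upper[of x t0 t] xy t0 elim by auto
      next
        case False
        then show ?thesis using lower[of y t t0] upper[of x t t0] xy t0 elim by auto
      qed
    qed
    then show ?thesis
      using continuous_of_squeezed_increments isF xy by blast
  qed
  then have contH: "continuous_on \<Theta> H" by (simp add: continuous_at_imp_continuous_on)
  have repr: "exp (- H t) * \<bar>\<psi> z t\<bar> = exp (F z t - H t)" if "z \<in> X" "t \<in> \<Theta>" "t \<noteq> \<theta> z" for z t
    using nonzero[OF that] by (simp add: F_def exp_diff exp_minus field_simps)
  show ?thesis
  proof (rule that)
    show "continuous_on \<Theta> (\<lambda>t. exp (- H t))" using contH by (intro continuous_intros)
    show "antimono_on \<Theta> (\<lambda>t. exp (- H t) * \<psi> z t)" if z: "z \<in> X" for z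
    proof (rule monotone_onI)
      fix s t assume st: "s \<in> \<Theta>" "t \<in> \<Theta>" "s \<le> t"
      \<comment> \<open>If the interval contains \<open>\<theta> z\<close>, then the signs at its ends decide.\<close>
      consider "t < \<theta> z" | "\<theta> z < s" | "s \<le> \<theta> z" "\<theta> z \<le> t" by linarith
      then show "exp (- H s) * \<psi> z s \<ge> exp (- H t) * \<psi> z t"
      proof cases
        case 1
        then have "exp (F z t - H t) \<le> exp (F z s - H s)" using lower[of z s t] st z by simp
        then show ?thesis using repr[of z s] repr[of z t] pos[of z s] pos[of z t] 1 st z by simp
      next
        case 2
        then have "exp (F z s - H s) \<le> exp (F z t - H t)" using upper[of z s t] st z by simp
        then show ?thesis using repr[of z s] repr[of z t] neg[of z s] neg[of z t] 2 st z
          by (simp del: exp_le_cancel_iff)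
      next
        case 3
        then have "\<psi> z s \<ge> 0" using pos[of z s] zero[OF z] z st by (cases "s = \<theta> z") auto
        moreover have "\<psi> z t \<le> 0"
          using 3 neg[of z t] zero[OF z] z st by (cases "t = \<theta> z") auto
        ultimately show ?thesis
          by (meson exp_ge_zero mult_nonneg_nonneg mult_nonneg_nonpos order_trans)
      qed
    qed
  qed auto
qed

section \<open>Primitives and their minima\<close>

lemma exists_primitive_on_open_interval:
  fixes g :: "real \<Rightarrow> real"
  assumes int: "is_interval \<Theta>" and op: "open \<Theta>" and cont: "continuous_on \<Theta> g"
  shows "\<exists>G. \<forall>t\<in>\<Theta>. (G has_real_derivative g t) (at t)"
proof (cases "\<Theta> = {}")
  case False
  then obtain c where c: "c \<in> \<Theta>" by blast
  define G where "G u = (LBINT y=c..u. g y)" for u :: real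
  have "(G has_real_derivative g t) (at t)" if t: "t \<in> \<Theta>" for t
  proof -
    obtain e where e: "e > 0" "cball t e \<subseteq> \<Theta>" using op t open_contains_cball by blast
    define a b where "a = min c (t - e)" and "b = max c (t + e)"
    have "t - e \<in> \<Theta>" "t + e \<in> \<Theta>" using e by (auto simp: dist_real_def subset_iff)
    then have "a \<in> \<Theta>" "b \<in> \<Theta>" using c by (auto simp: a_def b_def min_def max_def)
    then have "{a..b} \<subseteq> \<Theta>" using int unfolding is_interval_1 by (meson atLeastAtMost_iff subsetI)
    then have "continuous_on {a..b} g" using cont continuous_on_subset by blast
    moreover have "a \<le> c" "c \<le> b" "a < t" "t < b" using e by (auto simp: a_def b_def)
    ultimately have "(G has_vector_derivative g t) (at t within {a..b})"
      unfolding G_def by (intro interval_integral_FTC2) auto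
    moreover have "at t within {a..b} = at t"
      using \<open>a < t\<close> \<open>t < b\<close> by (intro at_within_interior) auto
    ultimately show ?thesis by (simp add: has_real_derivative_iff_has_vector_derivative)
  qed
  then show ?thesis by blast
qed auto

lemma argmin_set_eq_sign_change_of_derivative:
  assumes int: "is_interval \<Theta>" and \<theta>: "\<theta> \<in> \<Theta>"
    and der: "\<And>t. t \<in> \<Theta> \<Longrightarrow> (f has_real_derivative f' t) (at t)"
    and left: "\<And>t. t \<in> \<Theta> \<Longrightarrow> t < \<theta> \<Longrightarrow> f' t < 0"
    and right: "\<And>t. t \<in> \<Theta> \<Longrightarrow> \<theta> < t \<Longrightarrow> f' t > 0"
  shows "argmin_set \<Theta> f = {\<theta>}"
proof -
  have less: "f \<theta> < f t" if t: "t \<in> \<Theta>" "t \<noteq> \<theta>" for t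
  proof -
    have sub: "r \<in> \<Theta>" if "u \<in> \<Theta>" "v \<in> \<Theta>" "u \<le> r" "r \<le> v" for u v r
      using int that unfolding is_interval_1 by blast
    have cont: "continuous_on {u..v} f" if "u \<in> \<Theta>" "v \<in> \<Theta>" for u v
    proof (intro continuous_at_imp_continuous_on ballI)
      fix r assume "r \<in> {u..v}"
      then have "r \<in> \<Theta>" using sub[OF that] by simp
      then show "isCont f r" using der DERIV_isCont by blast
    qed
    show ?thesis
    proof (cases "t < \<theta>")
      case True
      show ?thesis
      proof (rule DERIV_neg_imp_decreasing_open[OF True])
        show "\<exists>y. (f has_real_derivative y) (at r) \<and> y < 0" if "t < r" "r < \<theta>" for r
          using der left sub[OF t(1) \<theta>] that by (meson less_imp_le)
      qed (use cont t \<theta> in auto)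
    next
      case False
      then have lt: "\<theta> < t" using t by simp
      show ?thesis
      proof (rule DERIV_pos_imp_increasing_open[OF lt])
        show "\<exists>y. (f has_real_derivative y) (at r) \<and> y > 0" if "\<theta> < r" "r < t" for r
          using der right sub[OF \<theta> t(1)] that by (meson less_imp_le)
      qed (use cont t \<theta> in auto)
    qed
  qed
  show ?thesis
    unfolding argmin_set_def using less \<theta> by (force intro: less_imp_le)
qed

lemma has_real_derivative_sum_list:
  assumes "\<And>x. x \<in> set xs \<Longrightarrow> (f x has_real_derivative f' x) (at t)"
  shows "((\<lambda>t. \<Sum>x\<leftarrow>xs. f x t) has_real_derivative (\<Sum>x\<leftarrow>xs. f' x)) (at t)"
  using assms by (induction xs) (auto intro!: derivative_eq_intros)

lemma C1_differentiable_on_open_iff: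
  fixes f :: "real \<Rightarrow> real"
  assumes "open S"
  shows "f C1_differentiable_on S \<longleftrightarrow>
    (\<exists>f'. continuous_on S f' \<and> (\<forall>t\<in>S. (f has_real_derivative f' t) (at t)))"
  unfolding C1_differentiable_on_def has_real_derivative_iff_has_vector_derivative by blast

section \<open>Convexification\<close>

theorem theorem2p2:
  fixes X :: "'a set" and \<Theta> :: "real set" and \<rho> \<psi> :: "'a \<Rightarrow> real \<Rightarrow> real"
  assumes "X \<noteq> {}"
    and "is_interval \<Theta>" and "open \<Theta>" and "\<exists>a\<in>\<Theta>. \<exists>b\<in>\<Theta>. a \<noteq> b"
    and "\<And>z. z \<in> X \<Longrightarrow> \<rho> z C1_differentiable_on \<Theta>"
    and "\<And>z t. z \<in> X \<Longrightarrow> t \<in> \<Theta> \<Longrightarrow> \<psi> z t = - deriv (\<rho> z) t"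
    and "\<psi> \<in> Psi_T_Z1 X \<Theta>"
    and "\<And>t. t \<in> \<Theta> \<Longrightarrow>
           \<exists>x\<in>X. \<exists>y\<in>X. vartheta X \<Theta> \<psi> 1 [x] < t \<and> t < vartheta X \<Theta> \<psi> 1 [y]"
    and "\<And>z. z \<in> X \<Longrightarrow> C2_differentiable_on_open (\<rho> z) (\<Theta> - {vartheta X \<Theta> \<psi> 1 [z]})"
  shows "\<exists>\<rho>' :: 'a \<Rightarrow> real \<Rightarrow> real.
           (\<forall>z\<in>X. convex_on \<Theta> (\<rho>' z) \<and> \<rho>' z C1_differentiable_on \<Theta>) \<and>
           (\<forall>n\<ge>1. \<forall>xs\<in>nlists n X.
              {vartheta X \<Theta> \<psi> n xs} = argmin_set \<Theta> (\<lambda>t. \<Sum>x\<leftarrow>xs. \<rho> x t) \<and>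
              argmin_set \<Theta> (\<lambda>t. \<Sum>x\<leftarrow>xs. \<rho> x t) = argmin_set \<Theta> (\<lambda>t. \<Sum>x\<leftarrow>xs. \<rho>' x t))"
proof -
  note int = assms(2) and op = assms(3)
  have der_rho: "(\<rho> z has_real_derivative - \<psi> z t) (at t)" if "z \<in> X" "t \<in> \<Theta>" for z t
    using assms(5)[OF that(1)] assms(6)[OF that] that(2) DERIV_imp_deriv
    unfolding C1_differentiable_on_open_iff[OF op] by (metis minus_minus)
  have cont_psi: "continuous_on \<Theta> (\<psi> z)" if z: "z \<in> X" for z
  proof -
    obtain D where D: "continuous_on \<Theta> D" "\<And>t. t \<in> \<Theta> \<Longrightarrow> (\<rho> z has_real_derivative D t) (at t)"
      using assms(5)[OF z] unfolding C1_differentiable_on_open_iff[OF op] by blast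
    have "\<psi> z t = - D t" if "t \<in> \<Theta>" for t
      using DERIV_unique[OF D(2)[OF that] der_rho[OF z that]] by simp
    then show ?thesis using continuous_on_minus[OF D(1)] by (simp cong: continuous_on_cong)
  qed
  have map: "is_sign_change_map X \<Theta> \<psi> n (vartheta X \<Theta> \<psi> n)" if "n \<ge> 1" for n
    using is_sign_change_map_vartheta[OF int] assms(7) that
    by (auto simp: Psi_T_Z1_def property_T_def)
  have vartheta_in: "vartheta X \<Theta> \<psi> n xs \<in> \<Theta>"
    and sum_pos: "\<And>t. t \<in> \<Theta> \<Longrightarrow> t < vartheta X \<Theta> \<psi> n xs \<Longrightarrow> (\<Sum>x\<leftarrow>xs. \<psi> x t) > 0"
    and sum_neg: "\<And>t. t \<in> \<Theta> \<Longrightarrow> vartheta X \<Theta> \<psi> n xs < t \<Longrightarrow> (\<Sum>x\<leftarrow>xs. \<psi> x t) < 0"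
    if "n \<ge> 1" "xs \<in> nlists n X" for n xs
    using map[OF that(1)] that(2) unfolding is_sign_change_map_def by blast+
  define \<theta> where "\<theta> z = vartheta X \<Theta> \<psi> 1 [z]" for z
  have single: "[z] \<in> nlists 1 X" if "z \<in> X" for z
    using that by (intro nlistsI) auto
  obtain p where p: "continuous_on \<Theta> p" "\<And>t. p t > 0"
    "\<And>z. z \<in> X \<Longrightarrow> antimono_on \<Theta> (\<lambda>t. p t * \<psi> z t)"
  proof (rule exists_monotonizing_factor[OF int op cont_psi, where \<theta> = \<theta>])
    show "\<psi> z t > 0" if "z \<in> X" "t \<in> \<Theta>" "t < \<theta> z" for z t
      using sum_pos[of 1 "[z]" t] single that by (simp add: \<theta>_def)
    show "\<psi> z t < 0" if "z \<in> X" "t \<in> \<Theta>" "\<theta> z < t" for z t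
      using sum_neg[of 1 "[z]" t] single that by (simp add: \<theta>_def)
    show "\<psi> z (\<theta> z) = 0" if "z \<in> X" for z
      using assms(7) that by (simp add: \<theta>_def Psi_T_Z1_def property_Z_1_def)
    show "\<exists>x\<in>X. \<exists>y\<in>X. \<theta> x < t \<and> t < \<theta> y" if "t \<in> \<Theta>" for t
      using assms(8)[OF that] by (simp add: \<theta>_def)
    show "(\<Sum>z\<leftarrow>xs. \<psi> z t) \<le> 0" if xs: "xs \<noteq> []" "set xs \<subseteq> X" and st: "s \<in> \<Theta>" "t \<in> \<Theta>" "s \<le> t"
      and less: "(\<Sum>z\<leftarrow>xs. \<psi> z s) < 0" for xs s t
    proof (cases "s = t")
      case False
      have n: "length xs \<ge> 1" using xs(1) by (cases xs) auto
      note l = nlistsI[OF refl xs(2)]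
      have "vartheta X \<Theta> \<psi> (length xs) xs \<le> s" using sum_pos[OF n l st(1)] less
        by (meson not_le less_asym)
      then show ?thesis using sum_neg[OF n l st(2)] st(3) False by linarith
    qed (use less in simp)
  qed (assumption | rule that)+
  have cont_p: "continuous_on \<Theta> (\<lambda>t. - (p t * \<psi> z t))" if "z \<in> X" for z
    using p(1) cont_psi[OF that] by (intro continuous_intros)
  define \<rho>' where "\<rho>' z = (SOME G. \<forall>t\<in>\<Theta>. (G has_real_derivative - (p t * \<psi> z t)) (at t))" for z
  have der_rho': "(\<rho>' z has_real_derivative - (p t * \<psi> z t)) (at t)" if "z \<in> X" "t \<in> \<Theta>" for z t
    using someI_ex[OF exists_primitive_on_open_interval[OF int op cont_p[OF that(1)]]] that(2)
    unfolding \<rho>'_def by blast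
  show ?thesis
  proof (intro exI[of _ \<rho>'] conjI ballI allI impI)
    fix z assume z: "z \<in> X"
    show "\<rho>' z C1_differentiable_on \<Theta>"
      unfolding C1_differentiable_on_open_iff[OF op] using cont_p[OF z] der_rho'[OF z] by blast
    show "convex_on \<Theta> (\<rho>' z)"
    proof (rule convex_on_realI)
      show "connected \<Theta>" using int is_interval_connected_1 by blast
      show "- (p s * \<psi> z s) \<le> - (p t * \<psi> z t)" if "s \<in> \<Theta>" "t \<in> \<Theta>" "s \<le> t" for s t
        using monotone_onD[OF p(3)[OF z] that] by simp
    qed (use der_rho' z in auto)
  next
    fix n xs assume n: "(1::nat) \<le> n" "xs \<in> nlists n X"
    have xs: "x \<in> X" if "x \<in> set xs" for x
      using nlistsE_set[OF n(2)] that by blast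
    note sgn = sum_pos[OF n] sum_neg[OF n]
    have "argmin_set \<Theta> (\<lambda>t. \<Sum>x\<leftarrow>xs. \<rho> x t) = {vartheta X \<Theta> \<psi> n xs}"
    proof (rule argmin_set_eq_sign_change_of_derivative[OF int vartheta_in[OF n]])
      show "((\<lambda>t. \<Sum>x\<leftarrow>xs. \<rho> x t) has_real_derivative - (\<Sum>x\<leftarrow>xs. \<psi> x t)) (at t)"
        if "t \<in> \<Theta>" for t
        using has_real_derivative_sum_list[of xs \<rho> "\<lambda>x. - \<psi> x t"] der_rho xs that
        by (simp add: uminus_sum_list_map o_def)
    qed (use sgn in auto)
    moreover have "argmin_set \<Theta> (\<lambda>t. \<Sum>x\<leftarrow>xs. \<rho>' x t) = {vartheta X \<Theta> \<psi> n xs}"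
    proof (rule argmin_set_eq_sign_change_of_derivative[OF int vartheta_in[OF n]])
      show "((\<lambda>t. \<Sum>x\<leftarrow>xs. \<rho>' x t) has_real_derivative - (p t * (\<Sum>x\<leftarrow>xs. \<psi> x t))) (at t)"
        if "t \<in> \<Theta>" for t
      proof -
        have "(\<Sum>x\<leftarrow>xs. - (p t * \<psi> x t)) = - (p t * (\<Sum>x\<leftarrow>xs. \<psi> x t))"
          by (induction xs) (auto simp: algebra_simps)
        then show ?thesis
          using has_real_derivative_sum_list[of xs \<rho>' "\<lambda>x. - (p t * \<psi> x t)" t] der_rho' xs that
          by simp
      qed
    qed (use sgn p(2) in \<open>auto simp: mult_pos_neg\<close>)
    ultimately show
      "{vartheta X \<Theta> \<psi> n xs} = argmin_set \<Theta> (\<lambda>t. \<Sum>x\<leftarrow>xs. \<rho> x t)"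
      "argmin_set \<Theta> (\<lambda>t. \<Sum>x\<leftarrow>xs. \<rho> x t) = argmin_set \<Theta> (\<lambda>t. \<Sum>x\<leftarrow>xs. \<rho>' x t)"
      by simp_all
  qed
qed

end
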